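(* Let $n_0\ge 1$ and $k\in\mathbb{N}$. If $f\in\operatorname{ReLU}^{\mathbb{R}}(n_0,k)$ and $f':\mathbb{R}^{n_0}\to\mathbb{R}$ is a function such that $f'-f=g$, where $g:\mathbb{R}^{n_0}\to\mathbb{R}$ is affine linear, then $f'\in\operatorname{ReLU}^{\mathbb{R}}(n_0,k)$.
   Context: For each $n$, let $\varsigma:\mathbb{R}^n\to\mathbb{R}^n$ be the map applying $x\mapsto\max\{0,x\}$ to each coordinate. A $(k+1)$-layer feedforward ReLU neural network (a network with $k$ hidden layers) is a composition $$\mathbb{R}^{n_0}\xrightarrow{\varsigma\circ A_1}\mathbb{R}^{n_1}\xrightarrow{\varsigma\circ A_2}\cdots\xrightarrow{\varsigma\circ A_k}\mathbb{R}^{n_k}\xrightarrow{A_{k+1}}\mathbb{R},$$ where the widths $n_1,\dots,n_k$ are arbitrary natural numbers and each $A_i$ is an affine linear map (no activation is applied after the last map $A_{k+1}$). $\operatorname{ReLU}^{\mathbb{R}}(n_0,k)$ is the set of functions $f:\mathbb{R}^{n_0}\to\mathbb{R}$ that are equal to such a composition with exactly $k$ hidden layers, for some choice of widths and of real affine maps. *)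

theory Defs
  imports Jordan_Normal_Form.Matrix
begin

text \<open>
  The space \<open>\<real>\<^sup>n\<close> is \<open>carrier_vec n :: real vec set\<close>, so that dimensions are values and may vary
  from layer to layer.  A function on \<open>\<real>\<^sup>n\<close> is a total HOL function on \<open>real vec\<close> of which only the
  values on \<open>carrier_vec n\<close> matter.
\<close>

definition affine_map :: "nat \<Rightarrow> nat \<Rightarrow> (real vec \<Rightarrow> real vec) \<Rightarrow> bool" where
  "affine_map m n A \<longleftrightarrow>
     (\<exists>M \<in> carrier_mat n m. \<exists>b \<in> carrier_vec n. \<forall>x \<in> carrier_vec m. A x = M *\<^sub>v x + b)"

text \<open>
  The case of codomain \<open>\<real>\<close>, with scalars in place of one-dimensional vectors: the matrix is a
  single row \<open>a\<close>.
\<close>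

definition affine_functional :: "nat \<Rightarrow> (real vec \<Rightarrow> real) \<Rightarrow> bool" where
  "affine_functional m g \<longleftrightarrow>
     (\<exists>a \<in> carrier_vec m. \<exists>c. \<forall>x \<in> carrier_vec m. g x = a \<bullet> x + c)"

definition relu :: "real vec \<Rightarrow> real vec" where
  "relu = map_vec (\<lambda>t. max 0 t)"

text \<open>The affine maps are numbered from \<open>0\<close>, so \<open>A i\<close> leads from layer \<open>i\<close> to layer \<open>Suc i\<close>.\<close>

primrec hidden_layers :: "(nat \<Rightarrow> real vec \<Rightarrow> real vec) \<Rightarrow> nat \<Rightarrow> real vec \<Rightarrow> real vec" where
  "hidden_layers A 0 = (\<lambda>x. x)"
| "hidden_layers A (Suc i) = relu \<circ> A i \<circ> hidden_layers A i"

text \<open>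
  In \<open>ReLU n k\<close>, \<open>w i\<close> is the width of layer \<open>i\<close> and \<open>L\<close> is the output map.  Width \<open>0\<close> is permitted;
  this adds no functions, since a layer of width \<open>0\<close> may be replaced by one of width \<open>1\<close> with
  constant value \<open>0\<close>.
\<close>

definition ReLU :: "nat \<Rightarrow> nat \<Rightarrow> (real vec \<Rightarrow> real) set" where
  "ReLU n k = {f. \<exists>w A L. w 0 = n \<and>
     (\<forall>i<k. affine_map (w i) (w (Suc i)) (A i)) \<and>
     affine_functional (w k) L \<and>
     (\<forall>x \<in> carrier_vec n. f x = L (hidden_layers A k x))}"

end

theory Submission imports Defs begin

text \<open>
  Every hidden layer is widened by two neurons that carry \<open>max 0 (g x)\<close> and \<open>max 0 (- g x)\<close>:
  these values are nonnegative, hence fixed by the activation, and so they can be copied from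
  layer to layer.  The output map then adds their difference, which is \<open>g x\<close>.
\<close>

definition vec_pair :: "'a \<Rightarrow> 'a \<Rightarrow> 'a vec" where
  "vec_pair a b = vec 2 (\<lambda>i. if i = 0 then a else b)"

lemma dim_vec_pair [simp]: "dim_vec (vec_pair a b) = 2"
  by (simp add: vec_pair_def)

lemma index_vec_pair [simp]: "vec_pair a b $ 0 = a" "vec_pair a b $ Suc 0 = b"
  by (simp_all add: vec_pair_def)

lemma affine_functional_add:
  assumes "affine_functional m g" "affine_functional m h"
  shows "affine_functional m (\<lambda>x. g x + h x)"
proof -
  obtain a c b d where a: "a \<in> carrier_vec m" "\<forall>x \<in> carrier_vec m. g x = a \<bullet> x + c"
    and b: "b \<in> carrier_vec m" "\<forall>x \<in> carrier_vec m. h x = b \<bullet> x + d"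
    using assms unfolding affine_functional_def by blast
  have "\<forall>x \<in> carrier_vec m. g x + h x = (a + b) \<bullet> x + (c + d)"
    using a b by (auto simp: add_scalar_prod_distrib)
  with a(1) b(1) show ?thesis
    unfolding affine_functional_def by (meson add_carrier_vec)
qed

lemma affine_functional_uminus:
  assumes "affine_functional m g"
  shows "affine_functional m (\<lambda>x. - g x)"
proof -
  obtain a c where a: "a \<in> carrier_vec m" "\<forall>x \<in> carrier_vec m. g x = a \<bullet> x + c"
    using assms unfolding affine_functional_def by blast
  then have "\<forall>x \<in> carrier_vec m. - g x = (- a) \<bullet> x + (- c)"
    by auto
  with a(1) show ?thesis
    unfolding affine_functional_def by (meson uminus_carrier_vec)
qed

lemma affine_functional_coordinate:
  assumes "i < m"
  shows "affine_functional m (\<lambda>x. x $ i)"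
  unfolding affine_functional_def
  using assms by (intro bexI[of _ "unit_vec m i"] exI[of _ 0]) auto

text \<open>Padding the coefficient vector with \<open>p\<close> zeros makes the functional blind to
  the last \<open>p\<close> coordinates. This lets the original layer maps and the output map act on
  widened layers.\<close>

lemma affine_functional_vec_first:
  assumes "affine_functional m g"
  shows "affine_functional (m + p) (\<lambda>x. g (vec_first x m))"
proof -
  obtain a c where a: "a \<in> carrier_vec m" and g: "\<forall>x \<in> carrier_vec m. g x = a \<bullet> x + c"
    using assms unfolding affine_functional_def by blast
  have "g (vec_first x m) = (a @\<^sub>v 0\<^sub>v p) \<bullet> x + c" if x: "x \<in> carrier_vec (m + p)" for x
  proof -
    have "(a @\<^sub>v 0\<^sub>v p) \<bullet> x = (a @\<^sub>v 0\<^sub>v p) \<bullet> (vec_first x m @\<^sub>v vec_last x p)"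
      using x by simp
    also have "\<dots> = a \<bullet> vec_first x m + 0\<^sub>v p \<bullet> vec_last x p"
      by (rule scalar_prod_append[OF a zero_carrier_vec]) auto
    finally show ?thesis using g by simp
  qed
  with a show ?thesis
    unfolding affine_functional_def by (meson append_carrier_vec zero_carrier_vec)
qed

lemma affine_map_carrier:
  "affine_map m n A \<Longrightarrow> x \<in> carrier_vec m \<Longrightarrow> A x \<in> carrier_vec n"
  unfolding affine_map_def by fastforce

lemma affine_map_coordinate:
  assumes "affine_map m n A" "i < n"
  shows "affine_functional m (\<lambda>x. A x $ i)"
proof -
  obtain M b where "M \<in> carrier_mat n m" "b \<in> carrier_vec n"
    "\<forall>x \<in> carrier_vec m. A x = M *\<^sub>v x + b"
    using assms(1) unfolding affine_map_def by blast
  with assms(2) show ?thesis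
    unfolding affine_functional_def
    by (intro bexI[of _ "row M i"] exI[of _ "b $ i"]) auto
qed

text \<open>The coefficient vectors of the coordinates become the rows of the matrix, and their
  constants form the translation. Layer maps can thus be shown affine one output neuron at a
  time.\<close>

lemma affine_map_if_coordinates:
  assumes carrier: "\<And>x. x \<in> carrier_vec m \<Longrightarrow> A x \<in> carrier_vec n"
    and coord: "\<And>i. i < n \<Longrightarrow> affine_functional m (\<lambda>x. A x $ i)"
  shows "affine_map m n A"
proof -
  \<comment> \<open>Coefficients are chosen simultaneously for all coordinates, as functions of the
    index \<open>i\<close>.\<close>
  obtain a c where a: "\<And>i. i < n \<Longrightarrow> a i \<in> carrier_vec m"
    and A: "\<And>i x. i < n \<Longrightarrow> x \<in> carrier_vec m \<Longrightarrow> A x $ i = a i \<bullet> x + c i"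
    using coord unfolding affine_functional_def by metis
  define M where "M = mat n m (\<lambda>(i, j). a i $ j)"
  have M: "M \<in> carrier_mat n m" by (simp add: M_def)
  have row: "row M i = a i" if "i < n" for i
    using a[OF that] that by (intro eq_vecI) (auto simp: M_def)
  have "A x = M *\<^sub>v x + vec n c" if "x \<in> carrier_vec m" for x
    using carrier[OF that] that M by (intro eq_vecI) (auto simp: A row)
  with M show ?thesis
    unfolding affine_map_def by (meson vec_carrier)
qed

lemma affine_map_append:
  assumes A: "affine_map m n A" and g: "affine_functional m g" and h: "affine_functional m h"
  shows "affine_map m (n + 2) (\<lambda>x. A x @\<^sub>v vec_pair (g x) (h x))"
proof (rule affine_map_if_coordinates)
  fix x :: "real vec" assume "x \<in> carrier_vec m"
  then show "A x @\<^sub>v vec_pair (g x) (h x) \<in> carrier_vec (n + 2)"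
    using affine_map_carrier[OF A] by (intro append_carrier_vec carrier_vecI) auto
next
  \<comment> \<open>The entries of the concatenation can be located only once \<open>A x\<close> is
    known to have dimension \<open>n\<close>, that is, for \<open>x\<close> in the carrier.
    Agreement there suffices, since \<open>affine_functional\<close> constrains no other
    values.\<close>
  have cong: "affine_functional m q"
    if "affine_functional m p" "\<And>x. x \<in> carrier_vec m \<Longrightarrow> q x = p x" for p q
    using that unfolding affine_functional_def by simp
  fix i assume "i < n + 2"
  then consider "i < n" | "i = n" | "i = Suc n" by linarith
  then show "affine_functional m (\<lambda>x. (A x @\<^sub>v vec_pair (g x) (h x)) $ i)"
  proof cases
    case 1
    show ?thesis
      by (rule cong[OF affine_map_coordinate[OF A 1]])
        (use 1 affine_map_carrier[OF A] in force)
  next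
    case 2
    show ?thesis
      by (rule cong[OF g]) (use 2 affine_map_carrier[OF A] in fastforce)
  next
    case 3
    show ?thesis
      by (rule cong[OF h]) (use 3 affine_map_carrier[OF A] in fastforce)
  qed
qed

lemma affine_map_vec_first:
  assumes A: "affine_map m n A"
  shows "affine_map (m + p) n (\<lambda>x. A (vec_first x m))"
  by (rule affine_map_if_coordinates)
    (auto intro: affine_map_carrier[OF A] affine_functional_vec_first affine_map_coordinate[OF A])

text \<open>The exact dimension of each layer is what later tells where the original neurons end and
  the two added ones begin.\<close>

lemma hidden_layers_carrier:
  assumes "\<forall>i<k. affine_map (w i) (w (Suc i)) (A i)" "x \<in> carrier_vec (w 0)" "j \<le> k"
  shows "hidden_layers A j x \<in> carrier_vec (w j)"
  using assms(3)
proof (induction j)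
  case 0
  then show ?case using assms(2) by simp
next
  case (Suc j)
  then show ?case
    using assms(1) affine_map_carrier[of "w j" "w (Suc j)" "A j"] by (auto simp: relu_def)
qed

lemma relu_append: "relu (u @\<^sub>v v) = relu u @\<^sub>v relu v"
  by (intro eq_vecI) (auto simp: relu_def)

lemma relu_pair: "relu (vec_pair a b) = vec_pair (max 0 a) (max 0 b)"
  by (intro eq_vecI) (auto simp: relu_def vec_pair_def)

lemma vec_first_append: "u \<in> carrier_vec n \<Longrightarrow> vec_first (u @\<^sub>v v) n = u"
  by (intro eq_vecI) (auto simp: vec_first_def)

theorem theorem1:
  fixes n\<^sub>0 k :: nat and f f' g :: "real vec \<Rightarrow> real"
  assumes "n\<^sub>0 \<ge> 1"
    and "f \<in> ReLU n\<^sub>0 k"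
    and "affine_functional n\<^sub>0 g"
    and "\<forall>x \<in> carrier_vec n\<^sub>0. f' x - f x = g x"
  shows "f' \<in> ReLU n\<^sub>0 k"
proof -
  obtain w A L where w0: "w 0 = n\<^sub>0"
    and A: "\<forall>i<k. affine_map (w i) (w (Suc i)) (A i)"
    and L: "affine_functional (w k) L"
    and f: "\<forall>x \<in> carrier_vec n\<^sub>0. f x = L (hidden_layers A k x)"
    using assms(2) unfolding ReLU_def by auto
  have f': "f' x = L (hidden_layers A k x) + g x" if "x \<in> carrier_vec n\<^sub>0" for x
    using assms(4) f that by (auto simp: algebra_simps)
  show ?thesis
  proof (cases k)
    case 0
    \<comment> \<open>Without hidden layers there are no neurons to add: the network is its output
      map, and \<open>g\<close> is added to it directly.\<close>
    have "affine_functional n\<^sub>0 (\<lambda>x. L x + g x)"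
      using affine_functional_add[of n\<^sub>0 L g] L assms(3) w0 0 by simp
    then show ?thesis
      using f' w0 0 unfolding ReLU_def
      by (auto intro!: exI[of _ w] exI[of _ "\<lambda>x. L x + g x"])
  next
    case (Suc l)
    \<comment> \<open>The input layer keeps its width; only layers with positive index gain two
      neurons.\<close>
    define w' where "w' i = (if i = 0 then n\<^sub>0 else w i + 2)" for i
    \<comment> \<open>The first map computes \<open>g x\<close> and \<open>- g x\<close> from the
      input, and the activation turns them into positive and negative part. Every later map copies
      them from positions \<open>w i\<close> and \<open>Suc (w i)\<close>, right behind the original
      neurons.\<close>
    define A' where "A' i = (if i = 0 then (\<lambda>x. A 0 x @\<^sub>v vec_pair (g x) (- g x))
      else (\<lambda>x. A i (vec_first x (w i)) @\<^sub>v vec_pair (x $ w i) (x $ Suc (w i))))" for i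
    \<comment> \<open>The difference is written as a sum with a negated term, which matches
      \<open>affine_functional_add\<close> and \<open>affine_functional_uminus\<close>.\<close>
    define L' where "L' x = L (vec_first x (w k)) + (x $ w k + - x $ Suc (w k))" for x
    have "affine_map (w' i) (w' (Suc i)) (A' i)" if "i < k" for i
    proof (cases "i = 0")
      case True
      have "affine_map n\<^sub>0 (w (Suc 0) + 2) (\<lambda>x. A 0 x @\<^sub>v vec_pair (g x) (- g x))"
        using A that True w0
        by (intro affine_map_append affine_functional_uminus assms(3)) auto
      then show ?thesis
        using True by (simp add: w'_def A'_def)
    next
      case False
      have "affine_map (w i + 2) (w (Suc i) + 2)
        (\<lambda>x. A i (vec_first x (w i)) @\<^sub>v vec_pair (x $ w i) (x $ Suc (w i)))"
        using A that
        by (intro affine_map_append affine_map_vec_first affine_functional_coordinate) auto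
      then show ?thesis
        using False by (simp add: w'_def A'_def)
    qed
    moreover have "affine_functional (w' k) L'"
    proof -
      have "affine_functional (w k + 2) L'"
        unfolding L'_def
        by (intro affine_functional_add affine_functional_vec_first affine_functional_uminus
            affine_functional_coordinate L) auto
      \<comment> \<open>Since \<open>k\<close> is positive, layer \<open>k\<close> is a widened
        one.\<close>
      then show ?thesis using Suc by (simp add: w'_def)
    qed
    moreover have "f' x = L' (hidden_layers A' k x)" if x: "x \<in> carrier_vec n\<^sub>0" for x
    proof -
      have H: "hidden_layers A j x \<in> carrier_vec (w j)" if "j \<le> k" for j
        using hidden_layers_carrier[OF A _ that] x w0 by simp
      \<comment> \<open>The invariant starts at layer \<open>Suc 0\<close>, because the input layer
        carries no added pair.\<close>
      have hidden: "hidden_layers A' (Suc j) x =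
        hidden_layers A (Suc j) x @\<^sub>v vec_pair (max 0 (g x)) (max 0 (- g x))" if "j < k" for j
        using that
      proof (induction j)
        case 0
        show ?case
          by (simp add: A'_def relu_append relu_pair)
      next
        case (Suc j)
        define u where "u = hidden_layers A (Suc j) x"
        have u: "u \<in> carrier_vec (w (Suc j))"
          using H[of "Suc j"] Suc.prems by (simp add: u_def)
        have "hidden_layers A' (Suc j) x = u @\<^sub>v vec_pair (max 0 (g x)) (max 0 (- g x))"
          using Suc by (simp add: u_def)
        then have "hidden_layers A' (Suc (Suc j)) x =
          relu (A' (Suc j) (u @\<^sub>v vec_pair (max 0 (g x)) (max 0 (- g x))))"
          by simp
        \<comment> \<open>As \<open>u\<close> has dimension \<open>w (Suc j)\<close>,
          \<open>vec_first\<close> returns \<open>u\<close> and the two copied entries are the pair;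
          \<open>max 0 (max 0 t) = max 0 t\<close> leaves the pair unchanged.\<close>
        also have "\<dots> = relu (A (Suc j) u) @\<^sub>v vec_pair (max 0 (g x)) (max 0 (- g x))"
          using u by (simp add: A'_def vec_first_append relu_append relu_pair)
        finally show ?case by (simp add: u_def)
      qed
      have "hidden_layers A k x \<in> carrier_vec (w k)" using H by simp
      moreover have "hidden_layers A' k x =
        hidden_layers A k x @\<^sub>v vec_pair (max 0 (g x)) (max 0 (- g x))"
        using hidden[of l] Suc by simp
      \<comment> \<open>Here \<open>max 0 t - max 0 (- t) = t\<close>, with \<open>t = g x\<close>,
        recovers the summand \<open>g x\<close>.\<close>
      ultimately show ?thesis
        using f'[OF x] by (auto simp: L'_def vec_first_append)
    qed
    ultimately show ?thesis
      unfolding ReLU_def by (auto simp: w'_def intro!: exI[of _ w'] exI[of _ A'] exI[of _ L'])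
  qed
qed

end
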